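(* Let $d, r \in \mathbb{N}$ and let $X \subseteq \mathbb{R}^d$ be a finite set with $\operatorname{rank}(X) \ge r$. There exists a set $T \subseteq X$ such that $|T| \le r/2 + 1$ and $$|X + T| \ge \frac{r|X|}{6}.$$
   Context: For $X \subseteq \mathbb{R}^d$, $\operatorname{rank}(X)$ is the minimum dimension of an affine subspace of $\mathbb{R}^d$ containing $X$. $X + T = \{x + t : x \in X, t \in T\}$. *)

theory Defs
  imports "HOL-Analysis.Analysis" "HOL-Library.Set_Algebras"
begin

text \<open>
  The library gives the empty affine set dimension -1.  Requiring the dimension to be a
  natural number restricts S to nonempty affine subspaces, so the empty set has rank 0.
  The name \<open>rank\<close> is already taken by the rank of a matrix.
\<close>

definition affine_rank :: "(real ^ 'n) set \<Rightarrow> nat" where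
  "affine_rank X = (LEAST k. \<exists>S. affine S \<and> X \<subseteq> S \<and> aff_dim S = int k)"

end

theory Submission
  imports Defs
begin

text \<open>
  Build T greedily, and let L be the direction space of its affine hull.  If more than two thirds
  of X lie off this hull, take a linear functional f that is constant on T and attains this value
  c at no point of X off the hull: adding to T the point of X that maximises f creates a new sum
  for each x in X with f x > c, and adding the minimiser does so for each x with f x < c, so one
  of the two gains at least |X|/3.  If instead the hull contains a part A of X with
  |A| \<ge> |X|/3, then discard T: as rank X exceeds dim L by at least r/2, X meets r/2 + 1 cosets
  of L, and the translates of A by representatives of these cosets are pairwise disjoint.
\<close>

text \<open>Induction on \<open>Z\<close>: adding to \<open>u\<close> a multiple of the component
  \<open>v\<close> of the new point orthogonal to \<open>L\<close> keeps the functional zero on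
  \<open>L\<close>, and only finitely many multiples make it vanish at a point of
  \<open>insert z Z\<close>.\<close>

lemma ex_functional_vanishing_on_subspace:
  fixes L Z :: "'a::euclidean_space set"
  assumes "subspace L" "finite Z" "Z \<inter> L = {}"
  shows "\<exists>u. (\<forall>l\<in>L. u \<bullet> l = 0) \<and> (\<forall>z\<in>Z. u \<bullet> z \<noteq> 0)"
  using assms(2,3)
proof (induction Z rule: finite_induct)
  case empty
  show ?case by (intro exI[of _ 0]) simp
next
  case (insert z Z)
  then obtain u where u: "\<forall>l\<in>L. u \<bullet> l = 0" "\<forall>z\<in>Z. u \<bullet> z \<noteq> 0" by auto
  obtain y v where yv: "y \<in> span L" "\<And>w. w \<in> span L \<Longrightarrow> orthogonal v w" "z = y + v"
    using orthogonal_subspace_decomp_exists[of L z] by metis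
  have sp: "span L = L" using assms(1) by (simp add: span_eq_iff)
  have vL: "\<forall>l\<in>L. v \<bullet> l = 0" using yv(2) sp by (auto simp: orthogonal_def)
  have "v \<noteq> 0" using yv(1,3) sp insert.prems by auto
  then have vz: "v \<bullet> z \<noteq> 0" using vL yv(1,3) sp by (auto simp: inner_add_right)
  \<comment> \<open>If \<open>v \<bullet> w \<noteq> 0\<close>, the quotient is the only
    \<open>e\<close> for which \<open>u + e *\<^sub>R v\<close> vanishes at \<open>w\<close>. If
    \<open>v \<bullet> w = 0\<close>, then \<open>w \<in> Z\<close>, and the value
    \<open>u \<bullet> w\<close> does not change with \<open>e\<close>.\<close>
  define bad where "bad = (\<lambda>w. - (u \<bullet> w) / (v \<bullet> w)) ` insert z Z \<union> {0}"
  have "finite bad" using insert.hyps by (simp add: bad_def)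
  then obtain e where e: "e \<notin> bad" using ex_new_if_finite infinite_UNIV_char_0 by blast
  have "(u + e *\<^sub>R v) \<bullet> w \<noteq> 0" if w: "w \<in> insert z Z" for w
  proof (cases "v \<bullet> w = 0")
    case True
    then show ?thesis using w u(2) vz by (auto simp: inner_add_left)
  next
    case False
    have "e \<noteq> - (u \<bullet> w) / (v \<bullet> w)" using e w unfolding bad_def by blast
    then show ?thesis using False by (simp add: inner_add_left field_simps add_eq_0_iff)
  qed
  moreover have "\<forall>l\<in>L. (u + e *\<^sub>R v) \<bullet> l = 0" using u(1) vL by (simp add: inner_add_left)
  ultimately show ?case by blast
qed

lemma card_sumset_insert:
  fixes X T :: "'a::euclidean_space set"
  assumes "finite X" "finite T" "P \<subseteq> X" "\<And>x. x \<in> P \<Longrightarrow> x + m \<notin> X + T"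
  shows "card (X + T) + card P \<le> card (X + insert m T)"
proof -
  have fin: "finite P" using assms finite_subset by blast
  have "(X + T) \<inter> (\<lambda>x. x + m) ` P = {}" using assms(4) by auto
  then have "card (X + T) + card P = card ((X + T) \<union> (\<lambda>x. x + m) ` P)"
    using assms(1,2) fin by (simp add: card_Un_disjoint card_image finite_set_plus)
  also have "\<dots> \<le> card (X + insert m T)"
    using assms by (intro card_mono finite_set_plus) (auto simp: set_plus_def)
  finally show ?thesis .
qed

text \<open>\<open>L\<close> is the direction space of the affine hull of \<open>T\<close>. A
  functional splits the points off the hull into two sides, and the better of its two extreme points
  gains at least half of them; the factors 2 avoid division.\<close>

lemma ex_sumset_insert_gain:
  fixes X T :: "'a::euclidean_space set"
  assumes "finite X" "T \<subseteq> X" "t0 \<in> T"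
  defines "L \<equiv> span ((\<lambda>t. t - t0) ` (T - {t0}))"
  shows "\<exists>m\<in>X. 2 * card (X + T) + card {x \<in> X. x - t0 \<notin> L} \<le> 2 * card (X + insert m T)"
proof -
  have finT: "finite T" using assms finite_subset by blast
  let ?Z = "(\<lambda>x. x - t0) ` {x \<in> X. x - t0 \<notin> L}"
  obtain u where u: "\<forall>l\<in>L. u \<bullet> l = 0" "\<forall>z\<in>?Z. u \<bullet> z \<noteq> 0"
    using ex_functional_vanishing_on_subspace[of L ?Z] assms(1) unfolding L_def by auto
  define c where "c = u \<bullet> t0"
  have uT: "u \<bullet> t = c" if "t \<in> T" for t
  proof (cases "t = t0")
    case False
    then have "t - t0 \<in> L" using that unfolding L_def by (auto intro: span_base)
    then show ?thesis using u(1) by (auto simp: c_def inner_diff_right)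
  qed (simp add: c_def)
  have ne: "X \<noteq> {}" using assms by blast
  have "Max ((\<bullet>) u ` X) \<in> (\<bullet>) u ` X" using assms(1) ne by (intro Max_in) auto
  then obtain m where mX: "m \<in> X" "Max ((\<bullet>) u ` X) = u \<bullet> m" by blast
  have m: "u \<bullet> x \<le> u \<bullet> m" if "x \<in> X" for x
    unfolding mX(2)[symmetric] using assms(1) that by (intro Max_ge) auto
  have "Min ((\<bullet>) u ` X) \<in> (\<bullet>) u ` X" using assms(1) ne by (intro Min_in) auto
  then obtain n where nX: "n \<in> X" "Min ((\<bullet>) u ` X) = u \<bullet> n" by blast
  have n: "u \<bullet> n \<le> u \<bullet> x" if "x \<in> X" for x
    unfolding nX(2)[symmetric] using assms(1) that by (intro Min_le) auto
  let ?P = "{x \<in> X. c < u \<bullet> x}" and ?N = "{x \<in> X. u \<bullet> x < c}"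
  \<comment> \<open>In \<open>x + m = y + t\<close> the functional would exceed
    \<open>c + u \<bullet> m\<close> on the left but not on the right.\<close>
  have "x + m \<notin> X + T" if "x \<in> ?P" for x
  proof
    assume "x + m \<in> X + T"
    then obtain y t where yt: "y \<in> X" "t \<in> T" "x + m = y + t" by (auto simp: set_plus_def)
    have "u \<bullet> x + u \<bullet> m = u \<bullet> y + u \<bullet> t" using yt(3) by (metis inner_add_right)
    then show False using that m[OF yt(1)] uT[OF yt(2)] by simp
  qed
  then have P: "card (X + T) + card ?P \<le> card (X + insert m T)"
    using assms(1) finT by (intro card_sumset_insert) auto
  have "x + n \<notin> X + T" if "x \<in> ?N" for x
  proof
    assume "x + n \<in> X + T"
    then obtain y t where yt: "y \<in> X" "t \<in> T" "x + n = y + t" by (auto simp: set_plus_def)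
    have "u \<bullet> x + u \<bullet> n = u \<bullet> y + u \<bullet> t" using yt(3) by (metis inner_add_right)
    then show False using that n[OF yt(1)] uT[OF yt(2)] by simp
  qed
  then have N: "card (X + T) + card ?N \<le> card (X + insert n T)"
    using assms(1) finT by (intro card_sumset_insert) auto
  have "{x \<in> X. x - t0 \<notin> L} \<subseteq> ?P \<union> ?N"
    using u(2) by (auto simp: inner_diff_right c_def)
  then have "card {x \<in> X. x - t0 \<notin> L} \<le> card (?P \<union> ?N)"
    using assms(1) by (intro card_mono) auto
  also have "\<dots> \<le> card ?P + card ?N" by (rule card_Un_le)
  finally have "card {x \<in> X. x - t0 \<notin> L} \<le> card ?P + card ?N" .
  then have "2 * card (X + T) + card {x \<in> X. x - t0 \<notin> L} \<le> 2 * card (X + insert m T) \<or>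
    2 * card (X + T) + card {x \<in> X. x - t0 \<notin> L} \<le> 2 * card (X + insert n T)"
    using P N by linarith
  then show ?thesis using mX(1) nX(1) by blast
qed

text \<open>The translate of \<open>span B\<close> by \<open>a\<close> is a nonempty affine set of
  dimension \<open>dim B\<close>, hence a competitor in the minimum that defines the rank.\<close>

lemma affine_rank_le_card:
  fixes X :: "(real ^ 'd) set"
  assumes "finite B" "\<And>x. x \<in> X \<Longrightarrow> x - a \<in> span B"
  shows "affine_rank X \<le> card B"
proof -
  let ?S = "(+) a ` span B"
  have "affine ?S" by (intro affine_translation[THEN iffD1] subspace_imp_affine) simp
  moreover have "X \<subseteq> ?S"
  proof
    fix x assume "x \<in> X"
    then show "x \<in> ?S" using assms(2)[of x] by (intro image_eqI[of _ _ "x - a"]) auto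
  qed
  moreover have "aff_dim ?S = int (dim B)"
    by (simp add: aff_dim_translation_eq aff_dim_subspace)
  ultimately have "affine_rank X \<le> dim B"
    unfolding affine_rank_def by (intro Least_le) blast
  also have "\<dots> \<le> card B" using assms(1) by (rule dim_le_card')
  finally show ?thesis .
qed

text \<open>Representatives of distinct cosets of \<open>span B\<close> are picked one at a time; if
  no further coset were met, too few vectors would span \<open>X\<close> up to translation.\<close>

lemma ex_transversal:
  fixes X :: "(real ^ 'd) set"
  assumes "X \<noteq> {}" "finite B" "n + card B \<le> affine_rank X"
  shows "\<exists>S\<subseteq>X. finite S \<and> card S = Suc n \<and> (\<forall>s\<in>S. \<forall>s'\<in>S. s - s' \<in> span B \<longrightarrow> s = s')"
  using assms(3)
proof (induction n)
  case 0
  obtain x where "x \<in> X" using assms(1) by blast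
  then show ?case by (intro exI[of _ "{x}"]) auto
next
  case (Suc n)
  then obtain S where S: "S \<subseteq> X" "finite S" "card S = Suc n"
    "\<forall>s\<in>S. \<forall>s'\<in>S. s - s' \<in> span B \<longrightarrow> s = s'" by auto
  then obtain s0 where s0: "s0 \<in> S" by fastforce
  have "\<exists>x\<in>X. \<forall>s\<in>S. x - s \<notin> span B"
  proof (rule ccontr)
    assume "\<not> ?thesis"
    then have *: "\<exists>s\<in>S. x - s \<in> span B" if "x \<in> X" for x using that by blast
    \<comment> \<open>Measured from \<open>s0\<close>, the \<open>n + 1\<close> points of
      \<open>S\<close> contribute only \<open>n\<close> differences, so the rank would be at most
      \<open>n + card B\<close>, one too small.\<close>
    let ?C = "(\<lambda>s. s - s0) ` (S - {s0}) \<union> B"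
    have "x - s0 \<in> span ?C" if x: "x \<in> X" for x
    proof -
      obtain s where s: "s \<in> S" "x - s \<in> span B" using *[OF x] by blast
      have "x - s \<in> span ?C" using s(2) span_mono[of B ?C] by blast
      moreover have "s - s0 \<in> span ?C"
        using s(1) by (cases "s = s0") (auto intro: span_base span_zero)
      ultimately have "(x - s) + (s - s0) \<in> span ?C" by (rule span_add)
      then show ?thesis by simp
    qed
    then have "affine_rank X \<le> card ?C"
      using S(2) assms(2) by (intro affine_rank_le_card) auto
    also have "\<dots> \<le> card ((\<lambda>s. s - s0) ` (S - {s0})) + card B" by (rule card_Un_le)
    also have "\<dots> \<le> card (S - {s0}) + card B" using S(2) by (simp add: card_image_le)
    also have "\<dots> = n + card B" using S(2,3) s0 by simp
    finally show False using Suc.prems by simp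
  qed
  then obtain x where x: "x \<in> X" "\<forall>s\<in>S. x - s \<notin> span B" by blast
  have x': "\<forall>s\<in>S. s - x \<notin> span B" using x(2) by (metis minus_diff_eq span_neg)
  have "x \<notin> S" using x(2) span_zero by fastforce
  then show ?case using S x x' by (intro exI[of _ "insert x S"]) auto
qed

text \<open>A sum determines its summands: \<open>a + s = a' + s'\<close> puts \<open>s - s'\<close>
  in \<open>L\<close>, so \<open>s = s'\<close> and then \<open>a = a'\<close>.\<close>

lemma card_transversal_sumset:
  fixes X S A :: "'a::euclidean_space set"
  assumes "finite X" "finite S" "A \<subseteq> X"
    and "\<And>a a'. a \<in> A \<Longrightarrow> a' \<in> A \<Longrightarrow> a' - a \<in> L"
    and "\<And>s s'. s \<in> S \<Longrightarrow> s' \<in> S \<Longrightarrow> s - s' \<in> L \<Longrightarrow> s = s'"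
  shows "card S * card A \<le> card (X + S)"
proof -
  have "inj_on (\<lambda>(s, a). a + s) (S \<times> A)"
  proof (rule inj_onI, clarsimp)
    fix s a s' a'
    assume *: "s \<in> S" "a \<in> A" "s' \<in> S" "a' \<in> A" "a + s = a' + s'"
    then have "s - s' = a' - a" by (simp add: algebra_simps)
    then have "s = s'" using * assms(4,5) by metis
    then show "s = s' \<and> a = a'" using * by simp
  qed
  then have "card S * card A = card ((\<lambda>(s, a). a + s) ` (S \<times> A))"
    by (simp add: card_image card_cartesian_product)
  also have "\<dots> \<le> card (X + S)"
    using assms(1-3) by (intro card_mono finite_set_plus) (auto simp: set_plus_def)
  finally show ?thesis .
qed

text \<open>By \<open>no_transversal\<close> the hull of the current \<open>T\<close> always holds
  less than a third of \<open>X\<close>, so each new point gains at least a third of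
  \<open>card X\<close>. The 3 in \<open>n + 3\<close> accounts for the initial single point, where
  \<open>X + T\<close> has the size of \<open>X\<close>.\<close>

lemma greedy_sumset:
  fixes X :: "(real ^ 'd) set"
  assumes "finite X" "X \<noteq> {}" "r \<le> affine_rank X" "n \<le> r div 2"
    and no_transversal: "\<And>S. S \<subseteq> X \<Longrightarrow> card S = Suc (r div 2) \<Longrightarrow>
      3 * card (X + S) < Suc (r div 2) * card X"
  shows "\<exists>T\<subseteq>X. T \<noteq> {} \<and> card T \<le> Suc n \<and> (n + 3) * card X \<le> 3 * card (X + T)"
  using assms(4)
proof (induction n)
  case 0
  obtain x where x: "x \<in> X" using assms(2) by blast
  have "X + {x} = (\<lambda>y. y + x) ` X" by (auto simp: set_plus_def)
  then have "card (X + {x}) = card X" by (simp add: card_image)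
  then show ?case using x by (intro exI[of _ "{x}"]) auto
next
  case (Suc n)
  then obtain T where T: "T \<subseteq> X" "T \<noteq> {}" "card T \<le> Suc n" "(n + 3) * card X \<le> 3 * card (X + T)"
    by auto
  then obtain t0 where t0: "t0 \<in> T" by blast
  have finT: "finite T" using T(1) assms(1) finite_subset by blast
  define B where "B = (\<lambda>t. t - t0) ` (T - {t0})"
  have finB: "finite B" using finT by (simp add: B_def)
  have "card B \<le> card (T - {t0})" unfolding B_def using finT by (simp add: card_image_le)
  then have "card B \<le> n" using T(3) t0 finT by simp
  \<comment> \<open>Since \<open>card B \<le> n < r div 2\<close>, the sum is at most
    \<open>r\<close>; this is where the number of greedy steps is limited to half the rank.\<close>
  then have "r div 2 + card B \<le> affine_rank X" using assms(3) Suc.prems by linarith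
  then obtain S where S: "S \<subseteq> X" "finite S" "card S = Suc (r div 2)"
    "\<forall>s\<in>S. \<forall>s'\<in>S. s - s' \<in> span B \<longrightarrow> s = s'"
    using ex_transversal[OF assms(2) finB] by blast
  let ?A = "{x \<in> X. x - t0 \<in> span B}" and ?O = "{x \<in> X. x - t0 \<notin> span B}"
  have "a' - a \<in> span B" if "a \<in> ?A" "a' \<in> ?A" for a a'
    using that span_diff[of "a' - t0" B "a - t0"] by simp
  then have "card S * card ?A \<le> card (X + S)"
    using S assms(1) by (intro card_transversal_sumset[where L = "span B"]) auto
  then have "Suc (r div 2) * (3 * card ?A) < Suc (r div 2) * card X"
    using no_transversal[OF S(1,3)] S(3) by (simp add: algebra_simps)
  then have "3 * card ?A < card X" by (simp only: mult_less_cancel1)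
  moreover have "card X = card ?A + card ?O"
  proof -
    have "card (?A \<union> ?O) = card ?A + card ?O" using assms(1) by (intro card_Un_disjoint) auto
    moreover have "?A \<union> ?O = X" by blast
    ultimately show ?thesis by simp
  qed
  moreover obtain m where m: "m \<in> X" "2 * card (X + T) + card ?O \<le> 2 * card (X + insert m T)"
    using ex_sumset_insert_gain[OF assms(1) T(1) t0] unfolding B_def by blast
  \<comment> \<open>More than two thirds of \<open>X\<close> lie off the hull, and at least half of
    these are gained.\<close>
  ultimately have "3 * card (X + T) + card X \<le> 3 * card (X + insert m T)" by linarith
  then have "(Suc n + 3) * card X \<le> 3 * card (X + insert m T)"
    using T(4) by (simp add: distrib_right)
  moreover have "card (insert m T) \<le> Suc (Suc n)"
    using T(3) finT by (simp add: card_insert_if)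
  ultimately show ?case using m(1) T(1) by (intro exI[of _ "insert m T"]) auto
qed

theorem theorem3p1:
  fixes r :: nat and X :: "(real ^ 'd) set"
  assumes "finite X"
    and "affine_rank X \<ge> r"
  shows "\<exists>T. T \<subseteq> X \<and> real (card T) \<le> real r / 2 + 1
            \<and> real (card (X + T)) \<ge> real r * real (card X) / 6"
proof (cases "X = {}")
  case True
  then show ?thesis by auto
next
  case False
  \<comment> \<open>A bound common to both alternatives: its failure for all \<open>T\<close> rules
    out transversals, and then \<open>r div 2\<close> greedy steps give an even larger factor,
    \<open>r div 2 + 3\<close>.\<close>
  have "\<exists>T\<subseteq>X. card T \<le> Suc (r div 2) \<and> Suc (r div 2) * card X \<le> 3 * card (X + T)"
  proof (rule ccontr)
    assume none: "\<not> ?thesis"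
    then have "3 * card (X + S) < Suc (r div 2) * card X"
      if "S \<subseteq> X" "card S = Suc (r div 2)" for S
      using that by (metis le_refl linorder_not_le)
    from greedy_sumset[OF assms(1) False assms(2) le_refl this]
    obtain T where T: "T \<subseteq> X" "card T \<le> Suc (r div 2)"
      "(r div 2 + 3) * card X \<le> 3 * card (X + T)" by blast
    have "Suc (r div 2) * card X \<le> (r div 2 + 3) * card X" by (intro mult_right_mono) auto
    then show False using none T by (meson le_trans)
  qed
  then obtain T where T: "T \<subseteq> X" "card T \<le> Suc (r div 2)"
    "Suc (r div 2) * card X \<le> 3 * card (X + T)" by blast
  have "real (card T) \<le> real (Suc (r div 2))" using T(2) by simp
  also have "\<dots> \<le> real r / 2 + 1" by linarith
  finally have "real (card T) \<le> real r / 2 + 1" .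
  moreover have "r * card X \<le> 6 * card (X + T)"
  proof -
    \<comment> \<open>The \<open>Suc\<close> absorbs the rounding in \<open>r div 2\<close> when
      \<open>r\<close> is odd.\<close>
    have "r * card X \<le> (2 * Suc (r div 2)) * card X" by (intro mult_right_mono) auto
    also have "\<dots> \<le> 6 * card (X + T)" using T(3) by simp
    finally show ?thesis .
  qed
  then have "real r * real (card X) \<le> 6 * real (card (X + T))"
    by (metis of_nat_le_iff of_nat_mult of_nat_numeral)
  then have "real r * real (card X) / 6 \<le> real (card (X + T))" by simp
  ultimately show ?thesis using T(1) by blast
qed

end
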